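(* Let $\mathcal{X}$ be a non-empty finite set. Let $(\mathcal{R}^n)_{n\geq1}$, $\mathcal{R}^n\subseteq\mathcal{G}(\mathcal{X}^n)$, be a coherent, exchangeable and time-consistent family of sets of gambles, with associated frequency representation $\mathcal{H}$. Let $\check n\geq1$ and $\check m\in\mathcal{N}^{\check n}$. After updating with a sample with count vector $\check m$, the family $(\mathcal{R}^{\hat n}\rfloor\check m)_{\hat n\geq1}$ is still coherent, exchangeable and time-consistent, and has frequency representation $$\mathcal{H}\rfloor\check m:=\{p\in\mathcal{V}(\Sigma_{\mathcal{X}}):B_{\check m}p\in\mathcal{H}\}.$$
   Context: A gamble on a non-empty set $\Omega$ is a bounded function $\Omega\to\mathbb{R}$; $\mathcal{G}(\Omega)$ is the linear space of all gambles on $\Omega$. Write $f\geq g$ for the pointwise ordering, and $f>g$ iff $f\geq g$ and $f\neq g$. A set $\mathcal{R}\subseteq\mathcal{G}(\Omega)$ is coherent if: $0\notin\mathcal{R}$; $f>0$ implies $f\in\mathcal{R}$; $f\in\mathcal{R}$ and $\lambda>0$ imply $\lambda f\in\mathcal{R}$; $f_1,f_2\in\mathcal{R}$ implies $f_1+f_2\in\mathcal{R}$. For a permutation $\pi$ of $\{1,\dots,n\}$ put $\pi(x_1,\dots,x_n)=(x_{\pi(1)},\dots,x_{\pi(n)})$ and $\pi^tf=f\circ\pi$. A coherent set $\mathcal{R}\subseteq\mathcal{G}(\mathcal{X}^n)$ is exchangeable if $h+(f-\pi^tf)\in\mathcal{R}$ for all $h\in\mathcal{R}$, $f\in\mathcal{G}(\mathcal{X}^n)$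 and all permutations $\pi$. For $1\leq n_1\leq n_2$ and $f\in\mathcal{G}(\mathcal{X}^{n_1})$, $\mathrm{ext}_{n_1}^{n_2}(f)(x_1,\dots,x_{n_2})=f(x_1,\dots,x_{n_1})$. A family $(\mathcal{R}^n)_{n\geq1}$ with $\mathcal{R}^n\subseteq\mathcal{G}(\mathcal{X}^n)$ is coherent, exchangeable and time-consistent if each $\mathcal{R}^n$ is coherent and exchangeable and $\mathrm{ext}_{n_1}^{n_2}(\mathcal{R}^{n_1})=\mathcal{R}^{n_2}\cap\mathrm{ext}_{n_1}^{n_2}(\mathcal{G}(\mathcal{X}^{n_1}))$ for all $1\leq n_1\leq n_2$. $\mathcal{N}^n=\{m\in\mathbb{Z}_{\geq0}^{\mathcal{X}}:\sum_zm_z=n\}$; for $m\in\mathcal{N}^n$, $[m]$ is the set of $x\in\mathcal{X}^n$ in which each $z\in\mathcal{X}$ occurs exactly $m_z$ times (those with count vector $m$); $|[m]|=n!/\prod_zm_z!$. $\Sigma_{\mathcal{X}}=\{\theta\in\mathbb{R}^{\mathcal{X}}:\theta\geq0,\sum_x\theta_x=1\}$; $\mathcal{V}(\Sigma_{\mathcal{X}})$ is the linear space of polynomial functions on $\Sigma_{\mathcal{X}}$; $B_m(\theta)=|[m]|\prod_z\theta_z^{m_z}$ ($0^0=1$). For $f\in\mathcal{G}(\mathcal{X}^n)$, $\mathrm{Mn}^n(f)=\sum_{m\in\mathcal{N}^n}\bigl(\frac1{|[m]|}\sum_{y\in[m]}f(y)\bigr)B_m\in\mathcal{V}(\Sigma_{\mathcal{X}})$.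 The frequency representation of a coherent, exchangeable and time-consistent family $(\mathcal{R}^n)_{n\geq1}$ is the set $\mathcal{H}=\bigcup_{n\geq1}\mathrm{Mn}^n(\mathcal{R}^n)$. Updating: for $\check m\in\mathcal{N}^{\check n}$ and $\hat n\geq1$, $\mathcal{R}^{\hat n}\rfloor\check m:=\{f\in\mathcal{G}(\mathcal{X}^{\hat n}):fI_{C_{\check m}}\in\mathcal{R}^{\check n+\hat n}\}$, where $C_{\check m}=[\check m]\times\mathcal{X}^{\hat n}$ and $fI_{C_{\check m}}$ is the gamble $(y,z)\mapsto f(z)I_{C_{\check m}}(y,z)$ on $\mathcal{X}^{\check n}\times\mathcal{X}^{\hat n}$. *)

theory Defs
  imports "HOL-Analysis.Analysis" "HOL-Combinatorics.Combinatorics"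
begin

unbundle vec_syntax

(* A real function on a set D is represented by the function on the ambient type that agrees
   with it on D and is 0 outside D. Sums, scalar multiples, equality and the order of such
   representatives are then the pointwise ones on D. *)

definition gambles :: "'a set \<Rightarrow> ('a \<Rightarrow> real) set" where
  "gambles \<Omega> = {f. bounded (f ` \<Omega>) \<and> (\<forall>x. x \<notin> \<Omega> \<longrightarrow> f x = 0)}"

definition coherent :: "'a set \<Rightarrow> ('a \<Rightarrow> real) set \<Rightarrow> bool" where
  "coherent \<Omega> R \<longleftrightarrow>
     R \<subseteq> gambles \<Omega> \<and>
     (\<lambda>_. 0) \<notin> R \<and>
     (\<forall>f\<in>gambles \<Omega>. (\<lambda>_. 0) < f \<longrightarrow> f \<in> R) \<and>
     (\<forall>f\<in>R. \<forall>c>0. (\<lambda>x. c * f x) \<in> R) \<and>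
     (\<forall>f\<in>R. \<forall>g\<in>R. (\<lambda>x. f x + g x) \<in> R)"

(* The finite non-empty set of categories is a type of class finite; samples of size n are
   lists of length n. List positions, and hence permutations, are indexed from 0. *)

definition samples :: "nat \<Rightarrow> 'x list set" where
  "samples n = {xs. length xs = n}"

definition exchangeable :: "nat \<Rightarrow> ('x list \<Rightarrow> real) set \<Rightarrow> bool" where
  "exchangeable n R \<longleftrightarrow>
     (\<forall>h\<in>R. \<forall>f\<in>gambles (samples n). \<forall>\<pi>. \<pi> permutes {..<n} \<longrightarrow>
        (\<lambda>xs. h xs + (f xs - f (permute_list \<pi> xs))) \<in> R)"

definition ext :: "nat \<Rightarrow> nat \<Rightarrow> ('x list \<Rightarrow> real) \<Rightarrow> 'x list \<Rightarrow> real" where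
  "ext n1 n2 f = (\<lambda>xs. if xs \<in> samples n2 then f (take n1 xs) else 0)"

definition time_consistent :: "(nat \<Rightarrow> ('x list \<Rightarrow> real) set) \<Rightarrow> bool" where
  "time_consistent R \<longleftrightarrow>
     (\<forall>n1 n2. 1 \<le> n1 \<longrightarrow> n1 \<le> n2 \<longrightarrow>
        ext n1 n2 ` R n1 = R n2 \<inter> ext n1 n2 ` gambles (samples n1))"

(* Families are indexed by n >= 1; the value at 0 is irrelevant throughout. *)

definition coherent_exchangeable_time_consistent ::
    "(nat \<Rightarrow> ('x list \<Rightarrow> real) set) \<Rightarrow> bool" where
  "coherent_exchangeable_time_consistent R \<longleftrightarrow>
     (\<forall>n\<ge>1. coherent (samples n) (R n) \<and> exchangeable n (R n)) \<and> time_consistent R"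

definition count_vectors :: "nat \<Rightarrow> ('x::finite \<Rightarrow> nat) set" where
  "count_vectors n = {m. (\<Sum>z\<in>UNIV. m z) = n}"

definition count_atom :: "('x \<Rightarrow> nat) \<Rightarrow> 'x list set" where
  "count_atom m = {xs. \<forall>z. count_list xs z = m z}"

definition prob_simplex :: "(real ^ 'x::finite) set" where
  "prob_simplex = {\<theta>. (\<forall>x. 0 \<le> \<theta> $ x) \<and> (\<Sum>x\<in>UNIV. \<theta> $ x) = 1}"

definition simplex_polynomials :: "(real ^ 'x::finite \<Rightarrow> real) set" where
  "simplex_polynomials =
     {\<lambda>\<theta>. if \<theta> \<in> prob_simplex then q \<theta> else 0 | q. real_polynomial_function q}"

definition bernstein :: "('x::finite \<Rightarrow> nat) \<Rightarrow> real ^ 'x \<Rightarrow> real" where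
  "bernstein m = (\<lambda>\<theta>. if \<theta> \<in> prob_simplex
     then real (card (count_atom m)) * (\<Prod>z\<in>UNIV. (\<theta> $ z) ^ m z) else 0)"

definition Mn :: "nat \<Rightarrow> ('x::finite list \<Rightarrow> real) \<Rightarrow> real ^ 'x \<Rightarrow> real" where
  "Mn n f = (\<lambda>\<theta>. \<Sum>m\<in>count_vectors n.
     (1 / real (card (count_atom m)) * (\<Sum>y\<in>count_atom m. f y)) * bernstein m \<theta>)"

definition frequency_representation ::
    "(nat \<Rightarrow> ('x::finite list \<Rightarrow> real) set) \<Rightarrow> (real ^ 'x \<Rightarrow> real) set" where
  "frequency_representation R = (\<Union>n\<in>{1..}. Mn n ` R n)"

(* The gamble f I_C on samples of size k + n, with C = count_atom m \<times> samples n, for a count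
   vector m of total k and a gamble f on samples of size n. *)

definition conditioned :: "nat \<Rightarrow> ('x \<Rightarrow> nat) \<Rightarrow> nat \<Rightarrow> ('x list \<Rightarrow> real) \<Rightarrow> 'x list \<Rightarrow> real" where
  "conditioned k m n f =
     (\<lambda>xs. f (drop k xs) * indicator {ys @ zs | ys zs. ys \<in> count_atom m \<and> zs \<in> samples n} xs)"

definition update_family ::
    "nat \<Rightarrow> ('x \<Rightarrow> nat) \<Rightarrow> (nat \<Rightarrow> ('x list \<Rightarrow> real) set) \<Rightarrow> nat \<Rightarrow> ('x list \<Rightarrow> real) set" where
  "update_family k m R n = {f \<in> gambles (samples n). conditioned k m n f \<in> R (k + n)}"

definition update_representation ::
    "('x::finite \<Rightarrow> nat) \<Rightarrow> (real ^ 'x \<Rightarrow> real) set \<Rightarrow> (real ^ 'x \<Rightarrow> real) set" where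
  "update_representation m H = {p \<in> simplex_polynomials. (\<lambda>\<theta>. bernstein m \<theta> * p \<theta>) \<in> H}"

(* The sums in Mn range over finite sets. *)

lemma finite_count_vectors: "finite (count_vectors n :: ('x::finite \<Rightarrow> nat) set)"
proof (rule finite_subset)
  show "count_vectors n \<subseteq> (UNIV :: 'x set) \<rightarrow>\<^sub>E {..n}"
    by (auto simp: count_vectors_def intro!: member_le_sum)
  show "finite ((UNIV :: 'x set) \<rightarrow>\<^sub>E {..n})"
    by (rule finite_PiE) auto
qed

lemma count_atom_eq_permutations_of_multiset:
  fixes m :: "'x::finite \<Rightarrow> nat"
  shows "count_atom m = permutations_of_multiset (Abs_multiset m)"
  by (auto simp: count_atom_def permutations_of_multiset_def multiset_eq_iff
      count_mset Abs_multiset_inverse)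

lemma finite_count_atom: "finite (count_atom m)" for m :: "'x::finite \<Rightarrow> nat"
  by (simp add: count_atom_eq_permutations_of_multiset)

lemma count_atom_subset_samples:
  fixes m :: "'x::finite \<Rightarrow> nat"
  assumes "m \<in> count_vectors n"
  shows "count_atom m \<subseteq> samples n"
proof
  fix xs assume xs: "xs \<in> count_atom m"
  have "length xs = (\<Sum>z\<in>set xs. count_list xs z)"
    by (rule sum_count_set[symmetric]) auto
  also have "\<dots> = (\<Sum>z\<in>UNIV. count_list xs z)"
    by (rule sum.mono_neutral_left) (auto simp: count_list_0_iff)
  also have "\<dots> = n"
    using xs assms by (simp add: count_atom_def count_vectors_def)
  finally show "xs \<in> samples n" by (simp add: samples_def)
qed

end

theory Submission
  imports Defs
begin

text \<open>
  Since \<open>B\<^sub>m / |[m]|\<close> is the monomial \<open>\<theta>\<^sup>m\<close>, the polynomial \<open>Mn n f\<close> is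
  the expectation \<open>\<Sum>x. f x * \<theta> x\<^sub>1 \<cdots> \<theta> x\<^sub>n\<close> of \<open>f\<close> under i.i.d. sampling. Hence
  \<open>Mn\<close> turns tensor products of gambles into products of polynomials; in particular
  conditioning on \<open>[m]\<close> becomes multiplication by \<open>B\<^sub>m\<close>, and every polynomial on the
  simplex has the form \<open>Mn n f\<close>. If \<open>B\<^sub>m p = Mn N g\<close> with \<open>g\<close> desirable, extend
  all samples to a common length: the conditioned gamble representing \<open>B\<^sub>m p\<close> then differs from
  \<open>g\<close> by an element of the kernel of \<open>Mn\<close>. Such an element sums to zero over every
  count atom, so it is a sum of gambles \<open>f - \<pi>\<^sup>t f\<close>, which exchangeability allows to be added.
\<close>

section \<open>Samples and count atoms\<close>

lemma finite_samples: "finite (samples n :: 'x::finite list set)"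
  using finite_lists_length_eq[of "UNIV :: 'x set" n] by (simp add: samples_def)

lemma mem_gambles_samples_iff:
  fixes f :: "'x::finite list \<Rightarrow> real"
  shows "f \<in> gambles (samples n) \<longleftrightarrow> (\<forall>xs. length xs \<noteq> n \<longrightarrow> f xs = 0)"
  using finite_samples[where 'x='x] by (auto simp: gambles_def samples_def finite_imp_bounded)

lemma count_atom_nonempty: "count_atom (m :: 'x::finite \<Rightarrow> nat) \<noteq> {}"
  by (simp add: count_atom_eq_permutations_of_multiset permutations_of_multiset_nonempty)

lemma length_count_atom:
  assumes "m \<in> count_vectors n" "xs \<in> count_atom (m :: 'x::finite \<Rightarrow> nat)"
  shows "length xs = n"
  using count_atom_subset_samples[OF assms(1)] assms(2) by (auto simp: samples_def)

lemma count_list_in_count_vectors: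
  fixes xs :: "'x::finite list"
  shows "count_list xs \<in> count_vectors (length xs)"
proof -
  have "(\<Sum>z\<in>UNIV. count_list xs z) = length xs"
    by (rule sum_count_set) auto
  then show ?thesis by (simp add: count_vectors_def)
qed

lemma sum_samples_add:
  fixes F :: "'x::finite list \<Rightarrow> 'x list \<Rightarrow> real"
  shows "(\<Sum>xs\<in>samples (a + b). F (take a xs) (drop a xs)) =
    (\<Sum>ys\<in>samples a. \<Sum>zs\<in>samples b. F ys zs)"
  unfolding sum.cartesian_product
  by (rule sum.reindex_bij_witness[of _ "\<lambda>(ys, zs). ys @ zs" "\<lambda>xs. (take a xs, drop a xs)"])
    (auto simp: samples_def)

section \<open>The polynomial of a gamble as an i.i.d. expectation\<close>

definition list_monomial :: "real ^ 'x::finite \<Rightarrow> 'x list \<Rightarrow> real" where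
  "list_monomial \<theta> xs = prod_list (map (($) \<theta>) xs)"

lemma list_monomial_append:
  "list_monomial \<theta> (xs @ ys) = list_monomial \<theta> xs * list_monomial \<theta> ys"
  by (simp add: list_monomial_def)

lemma list_monomial_count: "list_monomial \<theta> xs = (\<Prod>z\<in>UNIV. (\<theta> $ z) ^ count_list xs z)"
proof (induction xs)
  case (Cons x xs)
  have "(\<Prod>z\<in>UNIV. (\<theta> $ z) ^ count_list (x # xs) z) =
      (\<Prod>z\<in>UNIV. (if z = x then \<theta> $ z else 1) * (\<theta> $ z) ^ count_list xs z)"
    by (intro prod.cong) auto
  also have "\<dots> = \<theta> $ x * list_monomial \<theta> xs"
    unfolding prod.distrib by (simp add: Cons.IH)
  finally show ?case by (simp add: list_monomial_def)
qed (simp add: list_monomial_def)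

text \<open>Unlike \<open>Mn\<close>, this is not cut off outside the simplex: it is a polynomial on
  the whole space, and its multiplicativity holds at every \<theta>.\<close>

definition iid_expectation :: "nat \<Rightarrow> ('x::finite list \<Rightarrow> real) \<Rightarrow> real ^ 'x \<Rightarrow> real" where
  "iid_expectation n f \<theta> = (\<Sum>xs\<in>samples n. f xs * list_monomial \<theta> xs)"

text \<open>All samples in an atom share one monomial, and the factor
  \<open>card (count_atom m)\<close> in \<open>bernstein m\<close> cancels the averaging. What
  remains is a sum over the atoms, which partition the samples of size \<open>n\<close>.\<close>

lemma Mn_eq_iid_expectation:
  fixes f :: "'x::finite list \<Rightarrow> real"
  shows "Mn n f \<theta> = (if \<theta> \<in> prob_simplex then iid_expectation n f \<theta> else 0)"
proof (cases "\<theta> \<in> prob_simplex")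
  case True
  have "(1 / real (card (count_atom m)) * (\<Sum>y\<in>count_atom m. f y)) * bernstein m \<theta> =
      (\<Sum>y\<in>{xs \<in> samples n. count_list xs = m}. f y * list_monomial \<theta> y)"
    if m: "m \<in> count_vectors n" for m :: "'x \<Rightarrow> nat"
  proof -
    have "card (count_atom m) \<noteq> 0"
      using count_atom_nonempty finite_count_atom by (metis card_0_eq)
    then have "(1 / real (card (count_atom m)) * (\<Sum>y\<in>count_atom m. f y)) * bernstein m \<theta> =
        (\<Sum>y\<in>count_atom m. f y) * (\<Prod>z\<in>UNIV. (\<theta> $ z) ^ m z)"
      using True by (simp add: bernstein_def)
    also have "\<dots> = (\<Sum>y\<in>count_atom m. f y * (\<Prod>z\<in>UNIV. (\<theta> $ z) ^ m z))"
      by (rule sum_distrib_right)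
    also have "\<dots> = (\<Sum>y\<in>count_atom m. f y * list_monomial \<theta> y)"
      by (intro sum.cong) (auto simp: list_monomial_count count_atom_def)
    also have "\<dots> = (\<Sum>y\<in>{xs \<in> samples n. count_list xs = m}. f y * list_monomial \<theta> y)"
      using count_atom_subset_samples[OF m] by (intro sum.cong) (auto simp: count_atom_def)
    finally show ?thesis .
  qed
  then have "Mn n f \<theta> = (\<Sum>m\<in>count_vectors n.
      \<Sum>y\<in>{xs \<in> samples n. count_list xs = m}. f y * list_monomial \<theta> y)"
    by (simp add: Mn_def)
  also have "\<dots> = iid_expectation n f \<theta>"
    unfolding iid_expectation_def
    by (rule sum.group[OF finite_samples finite_count_vectors])
      (use count_list_in_count_vectors in \<open>auto simp: samples_def\<close>)
  finally show ?thesis using True by simp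
qed (simp add: Mn_def bernstein_def)

section \<open>Tensor products, extension and conditioning\<close>

text \<open>The length guard makes the result a gamble for arbitrary factors, so constants and
  indicators can be inserted without truncation.\<close>

definition tensor ::
    "nat \<Rightarrow> nat \<Rightarrow> ('x list \<Rightarrow> real) \<Rightarrow> ('x list \<Rightarrow> real) \<Rightarrow> 'x list \<Rightarrow> real" where
  "tensor a b f g = (\<lambda>xs. if length xs = a + b then f (take a xs) * g (drop a xs) else 0)"

lemma tensor_in_gambles: "tensor a b f g \<in> gambles (samples (a + b))"
  for f :: "'x::finite list \<Rightarrow> real"
  by (simp add: mem_gambles_samples_iff tensor_def)

text \<open>Monomials multiply under concatenation, so the sum over samples of size
  \<open>a + b\<close> splits into a product of two sums.\<close>

lemma iid_expectation_tensor:
  "iid_expectation (a + b) (tensor a b f g) \<theta> = iid_expectation a f \<theta> * iid_expectation b g \<theta>"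
proof -
  have "iid_expectation (a + b) (tensor a b f g) \<theta> = (\<Sum>xs\<in>samples (a + b).
      (f (take a xs) * list_monomial \<theta> (take a xs)) * (g (drop a xs) * list_monomial \<theta> (drop a xs)))"
    unfolding iid_expectation_def
  proof (intro sum.cong refl)
    fix xs :: "'a list" assume "xs \<in> samples (a + b)"
    moreover have "list_monomial \<theta> xs = list_monomial \<theta> (take a xs) * list_monomial \<theta> (drop a xs)"
      by (simp flip: list_monomial_append)
    ultimately show "tensor a b f g xs * list_monomial \<theta> xs =
      (f (take a xs) * list_monomial \<theta> (take a xs)) * (g (drop a xs) * list_monomial \<theta> (drop a xs))"
      by (simp add: tensor_def samples_def)
  qed
  also have "\<dots> = iid_expectation a f \<theta> * iid_expectation b g \<theta>"
    unfolding iid_expectation_def sum_product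
    by (rule sum_samples_add[where F = "\<lambda>ys zs. (f ys * list_monomial \<theta> ys) * (g zs * list_monomial \<theta> zs)"])
  finally show ?thesis .
qed

lemma iid_expectation_add:
  "iid_expectation n (\<lambda>xs. f xs + g xs) \<theta> = iid_expectation n f \<theta> + iid_expectation n g \<theta>"
  by (simp add: iid_expectation_def algebra_simps sum.distrib)

lemma iid_expectation_diff:
  "iid_expectation n (\<lambda>xs. f xs - g xs) \<theta> = iid_expectation n f \<theta> - iid_expectation n g \<theta>"
  by (simp add: iid_expectation_def algebra_simps sum_subtractf)

lemma samples_Suc_0: "samples (Suc 0) = (\<lambda>x. [x]) ` UNIV"
  by (auto simp: samples_def length_Suc_conv)

lemma iid_expectation_one: "iid_expectation 1 f \<theta> = (\<Sum>z\<in>UNIV. f [z] * \<theta> $ z)"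
  by (simp add: iid_expectation_def samples_Suc_0 sum.reindex inj_on_def list_monomial_def)

lemma iid_expectation_const_one:
  fixes \<theta> :: "real ^ 'x::finite"
  assumes "\<theta> \<in> prob_simplex"
  shows "iid_expectation n (\<lambda>_. 1) \<theta> = 1"
proof (induction n)
  case 0
  have "samples 0 = {[] :: 'x list}" by (auto simp: samples_def)
  then show ?case by (simp add: iid_expectation_def list_monomial_def)
next
  case (Suc n)
  have "iid_expectation (1 + n) (\<lambda>_. 1) \<theta> = iid_expectation (1 + n) (tensor 1 n (\<lambda>_. 1) (\<lambda>_. 1)) \<theta>"
    by (simp add: iid_expectation_def tensor_def samples_def)
  also have "\<dots> = 1"
    using assms unfolding iid_expectation_tensor Suc iid_expectation_one by (simp add: prob_simplex_def)
  finally show ?case by simp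
qed

lemma ext_eq_tensor: "ext a (a + b) f = tensor a b f (\<lambda>_. 1)"
  by (auto simp: ext_def tensor_def samples_def)

lemma ext_in_gambles: "ext a b f \<in> gambles (samples b)" for f :: "'x::finite list \<Rightarrow> real"
  unfolding mem_gambles_samples_iff by (simp add: ext_def samples_def)

lemma iid_expectation_ext:
  assumes "\<theta> \<in> prob_simplex" "a \<le> b"
  shows "iid_expectation b (ext a b f) \<theta> = iid_expectation a f \<theta>"
proof -
  obtain c where "b = a + c" using assms(2) le_Suc_ex by blast
  then show ?thesis
    by (simp add: ext_eq_tensor iid_expectation_tensor iid_expectation_const_one[OF assms(1)])
qed

text \<open>Observations that the gamble ignores contribute a factor 1 on the simplex. This is what
  allows a change to a common sample size.\<close>

lemma Mn_ext: "a \<le> b \<Longrightarrow> Mn b (ext a b f) = Mn a f" for f :: "'x::finite list \<Rightarrow> real"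
  by (auto simp: Mn_eq_iid_expectation iid_expectation_ext)

text \<open>Sequences with count vector \<open>m\<close> have length \<open>k\<close>, so membership
  in the cylinder can be tested on the first \<open>k\<close> entries.\<close>

lemma conditioned_eq_tensor:
  fixes m :: "'x::finite \<Rightarrow> nat"
  assumes "m \<in> count_vectors k"
  shows "conditioned k m n f = tensor k n (indicator (count_atom m)) f"
proof
  fix xs :: "'x list"
  have "xs \<in> {ys @ zs | ys zs. ys \<in> count_atom m \<and> zs \<in> samples n} \<longleftrightarrow>
      length xs = k + n \<and> take k xs \<in> count_atom m"
  proof
    assume "length xs = k + n \<and> take k xs \<in> count_atom m"
    then have "xs = take k xs @ drop k xs" "take k xs \<in> count_atom m" "drop k xs \<in> samples n"
      by (simp_all add: samples_def)
    then show "xs \<in> {ys @ zs | ys zs. ys \<in> count_atom m \<and> zs \<in> samples n}" by blast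
  qed (use length_count_atom[OF assms] in \<open>auto simp: samples_def\<close>)
  then show "conditioned k m n f xs = tensor k n (indicator (count_atom m)) f xs"
    by (auto simp: conditioned_def tensor_def indicator_def)
qed

text \<open>The Bernstein polynomial is the probability of the count vector \<open>m\<close> in
  \<open>k\<close> independent draws: the samples in the atom are equally likely.\<close>

lemma iid_expectation_indicator_count_atom:
  fixes m :: "'x::finite \<Rightarrow> nat"
  assumes "m \<in> count_vectors k" "\<theta> \<in> prob_simplex"
  shows "iid_expectation k (indicator (count_atom m)) \<theta> = bernstein m \<theta>"
proof -
  have "iid_expectation k (indicator (count_atom m)) \<theta> = (\<Sum>xs\<in>count_atom m. list_monomial \<theta> xs)"
    unfolding iid_expectation_def
    by (rule sum.mono_neutral_cong_right[OF finite_samples count_atom_subset_samples[OF assms(1)]])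
      (auto simp: indicator_def)
  also have "\<dots> = (\<Sum>xs\<in>count_atom m. \<Prod>z\<in>UNIV. (\<theta> $ z) ^ m z)"
    by (intro sum.cong) (auto simp: list_monomial_count count_atom_def)
  finally show ?thesis using assms(2) by (simp add: bernstein_def)
qed

lemma Mn_conditioned:
  fixes m :: "'x::finite \<Rightarrow> nat"
  assumes "m \<in> count_vectors k"
  shows "Mn (k + n) (conditioned k m n f) = (\<lambda>\<theta>. bernstein m \<theta> * Mn n f \<theta>)"
  by (auto simp: Mn_eq_iid_expectation conditioned_eq_tensor[OF assms] iid_expectation_tensor
      iid_expectation_indicator_count_atom[OF assms])

section \<open>Polynomials on the simplex\<close>

lemma real_polynomial_function_iid_expectation:
  "real_polynomial_function (iid_expectation n f)" for f :: "'x::finite list \<Rightarrow> real"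
proof -
  have "real_polynomial_function (\<lambda>\<theta>. list_monomial \<theta> xs)" for xs :: "'x list"
  proof (induction xs)
    case (Cons x xs)
    have "real_polynomial_function (\<lambda>\<theta> :: real ^ 'x. \<theta> $ x)"
      by (intro real_polynomial_function.intros(1) bounded_linear_vec_nth)
    then have "real_polynomial_function (\<lambda>\<theta>. \<theta> $ x * list_monomial \<theta> xs)"
      using Cons by (rule real_polynomial_function.intros(4))
    then show ?case by (simp add: list_monomial_def)
  qed (simp add: list_monomial_def real_polynomial_function.intros(2))
  then have "real_polynomial_function (\<lambda>\<theta>. \<Sum>xs\<in>samples n. f xs * list_monomial \<theta> xs)"
    by (intro real_polynomial_function_sum finite_samples real_polynomial_function.intros(4)
        real_polynomial_function.intros(2))
  then show ?thesis by (simp add: iid_expectation_def[abs_def])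
qed

lemma Mn_in_simplex_polynomials: "Mn n f \<in> simplex_polynomials"
  for f :: "'x::finite list \<Rightarrow> real"
proof -
  have "Mn n f = (\<lambda>\<theta>. if \<theta> \<in> prob_simplex then iid_expectation n f \<theta> else 0)"
    by (simp add: Mn_eq_iid_expectation fun_eq_iff)
  then show ?thesis
    using real_polynomial_function_iid_expectation[of n f] unfolding simplex_polynomials_def by blast
qed

text \<open>Induction on the construction of \<open>q\<close>: a linear form needs one observation,
  a constant uses that the coordinates sum to 1, a sum is formed at a common sample size, and a
  product is a tensor product over disjoint blocks of observations.\<close>

lemma real_polynomial_function_eq_iid_expectation:
  fixes q :: "real ^ 'x::finite \<Rightarrow> real"
  assumes "real_polynomial_function q"
  shows "\<exists>n\<ge>1. \<exists>f\<in>gambles (samples n). \<forall>\<theta>\<in>prob_simplex. q \<theta> = iid_expectation n f \<theta>"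
  using assms
proof (induction q rule: real_polynomial_function.induct)
  case (linear q)
  \<comment> \<open>\<open>hd\<close> reads off the single observation, whose category gets the
    value of \<open>q\<close> at its unit vector; \<open>ext 1 1\<close> truncates to samples of
    size 1.\<close>
  define f where "f = ext 1 1 (\<lambda>xs. q (axis (hd xs) 1))"
  have "q \<theta> = iid_expectation 1 f \<theta>" for \<theta>
  proof -
    have "q \<theta> = q (\<Sum>z\<in>UNIV. \<theta> $ z *\<^sub>R axis z 1)"
      using basis_expansion[of \<theta>] by (simp add: scalar_mult_eq_scaleR)
    also have "\<dots> = (\<Sum>z\<in>UNIV. \<theta> $ z * q (axis z 1))"
      using bounded_linear.linear[OF linear] by (simp add: linear_sum linear_cmul)
    finally show ?thesis
      by (simp only: iid_expectation_one) (simp add: f_def ext_def samples_def mult.commute)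
  qed
  moreover have "f \<in> gambles (samples 1)" unfolding f_def by (rule ext_in_gambles)
  ultimately show ?case by blast
next
  case (const c)
  have "iid_expectation 1 (ext 1 1 (\<lambda>_. c)) \<theta> = c" if "\<theta> \<in> prob_simplex" for \<theta> :: "real ^ 'x"
    using that by (simp only: iid_expectation_one)
      (simp add: ext_def samples_def prob_simplex_def flip: sum_distrib_left)
  moreover have "ext 1 1 (\<lambda>_. c) \<in> gambles (samples 1 :: 'x list set)" by (rule ext_in_gambles)
  ultimately show ?case by (metis order_refl)
next
  case (add q r)
  then obtain a b f g where ab: "1 \<le> a" "1 \<le> b"
    and f: "\<forall>\<theta>\<in>prob_simplex. q \<theta> = iid_expectation a f \<theta>"
    and g: "\<forall>\<theta>\<in>prob_simplex. r \<theta> = iid_expectation b g \<theta>"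
    by metis
  let ?n = "max a b"
  let ?h = "\<lambda>xs. ext a ?n f xs + ext b ?n g xs"
  have "?h \<in> gambles (samples ?n)"
    unfolding mem_gambles_samples_iff by (simp add: ext_def samples_def)
  moreover have "\<forall>\<theta>\<in>prob_simplex. q \<theta> + r \<theta> = iid_expectation ?n ?h \<theta>"
    using f g by (simp add: iid_expectation_add iid_expectation_ext)
  moreover have "1 \<le> ?n" using ab by simp
  ultimately show ?case by blast
next
  case (mult q r)
  then obtain a b f g where ab: "1 \<le> a" "1 \<le> b"
    and f: "\<forall>\<theta>\<in>prob_simplex. q \<theta> = iid_expectation a f \<theta>"
    and g: "\<forall>\<theta>\<in>prob_simplex. r \<theta> = iid_expectation b g \<theta>"
    by metis
  have "\<forall>\<theta>\<in>prob_simplex. q \<theta> * r \<theta> = iid_expectation (a + b) (tensor a b f g) \<theta>"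
    using f g by (simp add: iid_expectation_tensor)
  moreover have "1 \<le> a + b" using ab by simp
  ultimately show ?case using tensor_in_gambles by blast
qed

lemma simplex_polynomial_eq_Mn:
  fixes p :: "real ^ 'x::finite \<Rightarrow> real"
  assumes "p \<in> simplex_polynomials"
  obtains n f where "1 \<le> n" "f \<in> gambles (samples n)" "p = Mn n f"
proof -
  obtain q where q: "real_polynomial_function q" "p = (\<lambda>\<theta>. if \<theta> \<in> prob_simplex then q \<theta> else 0)"
    using assms by (auto simp: simplex_polynomials_def)
  obtain n f where "1 \<le> n" "f \<in> gambles (samples n)"
      "\<forall>\<theta>\<in>prob_simplex. q \<theta> = iid_expectation n f \<theta>"
    using real_polynomial_function_eq_iid_expectation[OF q(1)] by auto
  then show thesis using q(2) by (intro that[of n f]) (auto simp: Mn_eq_iid_expectation)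
qed

section \<open>The kernel of \<open>Mn\<close>\<close>

text \<open>A function bounded by \<open>N\<close> is a string of digits in base
  \<open>N + 1\<close>; with powers of the base as weights, the weighted sum is the number with
  these digits and determines them.\<close>

lemma weight_separating_functions_on:
  assumes "finite A"
  shows "\<exists>w :: 'a \<Rightarrow> nat. \<forall>m m'. (\<forall>z\<in>A. m z \<le> N \<and> m' z \<le> N) \<longrightarrow>
    (\<Sum>z\<in>A. m z * w z) = (\<Sum>z\<in>A. m' z * w z) \<longrightarrow> (\<forall>z\<in>A. m z = m' z)"
  using assms
proof induction
  case (insert a A)
  then obtain w :: "'a \<Rightarrow> nat" where w: "\<forall>m m'. (\<forall>z\<in>A. m z \<le> N \<and> m' z \<le> N) \<longrightarrow>
      (\<Sum>z\<in>A. m z * w z) = (\<Sum>z\<in>A. m' z * w z) \<longrightarrow> (\<forall>z\<in>A. m z = m' z)"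
    by (elim exE)
  \<comment> \<open>The values become the digits in base \<open>N + 1\<close>, that of \<open>a\<close> being the last one.\<close>
  define v where "v = (\<lambda>z. if z = a then 1 else Suc N * w z)"
  have v: "(\<Sum>z\<in>insert a A. m z * v z) = m a + Suc N * (\<Sum>z\<in>A. m z * w z)" for m :: "'a \<Rightarrow> nat"
  proof -
    have "(\<Sum>z\<in>A. m z * v z) = (\<Sum>z\<in>A. Suc N * (m z * w z))"
      using insert.hyps by (intro sum.cong) (auto simp: v_def algebra_simps)
    also have "\<dots> = Suc N * (\<Sum>z\<in>A. m z * w z)" by (rule sum_distrib_left[symmetric])
    finally show ?thesis using insert.hyps by (simp add: v_def)
  qed
  show ?case
  proof (intro exI[of _ v] allI impI)
    fix m m' :: "'a \<Rightarrow> nat"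
    assume le: "\<forall>z\<in>insert a A. m z \<le> N \<and> m' z \<le> N"
      and "(\<Sum>z\<in>insert a A. m z * v z) = (\<Sum>z\<in>insert a A. m' z * v z)"
    then have eq: "m a + Suc N * (\<Sum>z\<in>A. m z * w z) = m' a + Suc N * (\<Sum>z\<in>A. m' z * w z)"
      by (simp only: v)
    \<comment> \<open>Reduction modulo \<open>Suc N\<close> recovers the last digit, which is at
      most \<open>N\<close>.\<close>
    have "m a = (m a + Suc N * (\<Sum>z\<in>A. m z * w z)) mod Suc N"
      using le by (simp only: mod_mult_self2) simp
    also have "\<dots> = m' a"
      using le unfolding eq by (simp only: mod_mult_self2) simp
    finally have "m a = m' a" .
    with eq have "(\<Sum>z\<in>A. m z * w z) = (\<Sum>z\<in>A. m' z * w z)" by (simp del: mult_Suc)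
    then show "\<forall>z\<in>insert a A. m z = m' z" using w le \<open>m a = m' a\<close> by simp
  qed
qed simp

text \<open>The scale \<open>c\<close>, later chosen to put the curve on the simplex, comes out as a
  power that depends only on the sample size.\<close>

lemma list_monomial_power:
  fixes w :: "'x::finite \<Rightarrow> nat"
  shows "list_monomial (\<chi> z. c * t ^ w z) xs = c ^ length xs * t ^ sum_list (map w xs)"
  by (induction xs) (simp_all add: list_monomial_def power_add)

lemma sum_list_map_count: "sum_list (map w xs) = (\<Sum>z\<in>UNIV. count_list xs z * w z)"
  for w :: "'x::finite \<Rightarrow> nat"
proof -
  have "sum_list (map w xs) = (\<Sum>z\<in>set xs. count_list xs z * w z)"
    by (rule sum_list_map_eq_sum_count)
  also have "\<dots> = (\<Sum>z\<in>UNIV. count_list xs z * w z)"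
    by (rule sum.mono_neutral_left) (auto simp: count_list_0_iff)
  finally show ?thesis .
qed

text \<open>Kronecker substitution: along the curve \<open>\<theta> z \<propto> t\<^bsup>w z\<^esup>\<close> with separating
  weights \<open>w\<close>, distinct monomials become distinct powers of \<open>t\<close>.\<close>

lemma sum_count_class_eq_0_if_Mn_eq_0:
  fixes h :: "'x::finite list \<Rightarrow> real"
  assumes "Mn n h = (\<lambda>_. 0)" "length ys = n"
  shows "(\<Sum>xs | mset xs = mset ys. h xs) = 0"
proof -
  obtain w :: "'x \<Rightarrow> nat" where w: "\<forall>m m'. (\<forall>z\<in>UNIV. m z \<le> n \<and> m' z \<le> n) \<longrightarrow>
      (\<Sum>z\<in>UNIV. m z * w z) = (\<Sum>z\<in>UNIV. m' z * w z) \<longrightarrow> (\<forall>z\<in>UNIV. m z = m' z)"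
    using weight_separating_functions_on[of "UNIV :: 'x set" n] by auto
  define e where "e xs = sum_list (map w xs)" for xs
  \<comment> \<open>Multiplicities in a sample of size \<open>n\<close> are at most
    \<open>n\<close>, so the separating weights make the exponent \<open>e xs\<close> determine the
    multiset.\<close>
  have e: "e xs = e ys \<longleftrightarrow> mset xs = mset ys" if "xs \<in> samples n" for xs
  proof
    assume "e xs = e ys"
    then have "(\<Sum>z\<in>UNIV. count_list xs z * w z) = (\<Sum>z\<in>UNIV. count_list ys z * w z)"
      by (simp add: e_def sum_list_map_count)
    moreover have "\<forall>z\<in>UNIV. count_list xs z \<le> n \<and> count_list ys z \<le> n"
      using that assms(2) count_le_length[of xs] count_le_length[of ys] by (auto simp: samples_def)
    ultimately have "\<forall>z. count_list xs z = count_list ys z"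
      using w by blast
    then show "mset xs = mset ys" by (simp add: multiset_eq_iff count_mset)
  next
    assume "mset xs = mset ys"
    then show "e xs = e ys"
      unfolding e_def by (metis mset_map sum_mset_sum_list)
  qed
  define P where "P = (\<Sum>xs\<in>samples n. monom (h xs) (e xs))"
  \<comment> \<open>Every positive \<open>t\<close> gives a point of the simplex after
    normalisation, where the expectation of \<open>h\<close> is \<open>c ^ n * poly P t\<close>.
    This yields infinitely many roots.\<close>
  have "poly P t = 0" if t: "t > 0" for t
  proof -
    define c where "c = 1 / (\<Sum>z\<in>UNIV. t ^ w z)"
    have pos: "(\<Sum>z\<in>UNIV. t ^ w z) > 0" using t by (intro sum_pos) auto
    then have "c > 0" by (simp add: c_def)
    let ?\<theta> = "(\<chi> z. c * t ^ w z) :: real ^ 'x"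
    have "(\<Sum>z\<in>UNIV. c * t ^ w z) = 1"
      using pos by (simp add: c_def flip: sum_distrib_left sum_divide_distrib)
    then have "?\<theta> \<in> prob_simplex"
      using t \<open>c > 0\<close> by (simp add: prob_simplex_def)
    then have "0 = iid_expectation n h ?\<theta>"
      using fun_cong[OF assms(1), of ?\<theta>] by (simp add: Mn_eq_iid_expectation)
    also have "\<dots> = (\<Sum>xs\<in>samples n. c ^ n * (h xs * t ^ e xs))"
      unfolding iid_expectation_def
      by (intro sum.cong) (auto simp: list_monomial_power e_def samples_def)
    also have "\<dots> = c ^ n * poly P t"
      by (simp add: P_def poly_sum poly_monom sum_distrib_left)
    finally show ?thesis using \<open>c > 0\<close> by simp
  qed
  then have "{0<..} \<subseteq> {t. poly P t = 0}" by auto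
  then have "infinite {t. poly P t = 0}"
    using infinite_Ioi[of "0::real"] finite_subset by blast
  then have "P = 0" using poly_roots_finite by blast
  \<comment> \<open>The coefficient at \<open>e ys\<close> collects \<open>h\<close> over exactly
    the permutations of \<open>ys\<close>.\<close>
  then have "0 = coeff P (e ys)" by simp
  also have "\<dots> = (\<Sum>xs\<in>samples n. if e xs = e ys then h xs else 0)"
    by (simp add: P_def coeff_sum)
  also have "\<dots> = (\<Sum>xs\<in>{xs \<in> samples n. e xs = e ys}. h xs)"
    by (rule sum.inter_filter[symmetric, OF finite_samples])
  also have "{xs \<in> samples n. e xs = e ys} = {xs. mset xs = mset ys}"
    using e assms(2) by (auto simp: samples_def dest: mset_eq_length)
  finally show ?thesis by simp
qed

section \<open>Kernel elements as sums of exchangeable differences\<close>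

lemma permute_list_eq_iff:
  assumes "\<pi> permutes {..<n}" "length xs = n" "length ys = n"
  shows "permute_list \<pi> xs = permute_list \<pi> ys \<longleftrightarrow> xs = ys"
proof
  assume eq: "permute_list \<pi> xs = permute_list \<pi> ys"
  have "permute_list (inv \<pi>) (permute_list \<pi> zs) = zs" if "length zs = n" for zs :: "'a list"
    using that permute_list_compose[of "inv \<pi>" zs \<pi>] permutes_inv[OF assms(1)]
      permutes_inv_o(1)[OF assms(1)]
    by simp
  then show "xs = ys" using eq assms(2,3) by metis
qed simp

text \<open>Exchangeability adds one difference; induction over \<open>I\<close> adds finitely many,
  each with its own gamble and permutation.\<close>

lemma exchangeable_add_sum:
  fixes R :: "('x::finite list \<Rightarrow> real) set"
  assumes "exchangeable n R" "g \<in> R" "finite I"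
    and "\<And>i. i \<in> I \<Longrightarrow> F i \<in> gambles (samples n) \<and> \<pi> i permutes {..<n}"
  shows "(\<lambda>xs. g xs + (\<Sum>i\<in>I. F i xs - F i (permute_list (\<pi> i) xs))) \<in> R"
  using assms(3,4)
proof induction
  case (insert i I)
  then have "(\<lambda>xs. g xs + (\<Sum>i\<in>I. F i xs - F i (permute_list (\<pi> i) xs))) \<in> R"
    and "F i \<in> gambles (samples n)" "\<pi> i permutes {..<n}"
    by simp_all
  then have "(\<lambda>xs. (g xs + (\<Sum>i\<in>I. F i xs - F i (permute_list (\<pi> i) xs))) +
      (F i xs - F i (permute_list (\<pi> i) xs))) \<in> R"
    by (rule assms(1)[unfolded exchangeable_def, rule_format])
  then show ?case using insert.hyps by (simp add: algebra_simps)
qed (use assms(2) in simp)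

text \<open>The difference \<open>h\<close> of \<open>f\<close> and \<open>g\<close> sums to zero
  over each permutation class. Moving its value at every sample to a representative of the class
  therefore cancels it, and each move is one exchangeable difference.\<close>

lemma exchangeable_mem_if_Mn_eq:
  fixes R :: "('x::finite list \<Rightarrow> real) set"
  assumes exch: "exchangeable n R" and "g \<in> R" "R \<subseteq> gambles (samples n)"
    and f: "f \<in> gambles (samples n)" and eq: "Mn n f = Mn n g"
  shows "f \<in> R"
proof -
  define h where "h xs = f xs - g xs" for xs
  have h0: "h xs = 0" if "length xs \<noteq> n" for xs
    using that assms by (auto simp: h_def mem_gambles_samples_iff)
  have "Mn n h = (\<lambda>_. 0)"
  proof
    show "Mn n h \<theta> = 0" for \<theta>
      using fun_cong[OF eq, of \<theta>] unfolding h_def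
      by (simp add: Mn_eq_iid_expectation iid_expectation_diff split: if_splits)
  qed
  note sum0 = sum_count_class_eq_0_if_Mn_eq_0[OF this]
  \<comment> \<open>The choice depends only on the multiset, so each class has a single
    representative.\<close>
  define rep where "rep xs = (SOME ys. mset ys = mset xs)" for xs :: "'x list"
  have mset_rep: "mset (rep xs) = mset xs" for xs
    unfolding rep_def by (rule someI[where P = "\<lambda>ys. mset ys = mset xs", OF refl])
  have rep_eq: "rep xs = rep ys" if "mset xs = mset ys" for xs ys
    using that by (simp add: rep_def)
  have "\<exists>p. p permutes {..<n} \<and> permute_list p (rep xs) = xs" if "length xs = n" for xs
    using that mset_eq_permutation[OF mset_rep[of xs, symmetric]] mset_eq_length[OF mset_rep[of xs]]
    by metis
  then obtain \<pi> where \<pi>: "\<And>xs. length xs = n \<Longrightarrow>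
      \<pi> xs permutes {..<n} \<and> permute_list (\<pi> xs) (rep xs) = xs"
    by metis
  \<comment> \<open>\<open>F xs\<close> is \<open>h\<close> restricted to the point
    \<open>xs\<close>; composed with \<open>permute_list (\<pi> xs)\<close> it is carried to the
    point \<open>rep xs\<close>.\<close>
  define F where "F xs = (\<lambda>ys. if ys = xs then h xs else 0)" for xs
  have "F xs \<in> gambles (samples n) \<and> \<pi> xs permutes {..<n}" if "xs \<in> samples n" for xs
    unfolding mem_gambles_samples_iff using \<pi> that by (auto simp: F_def samples_def)
  then have "(\<lambda>ys. g ys + (\<Sum>xs\<in>samples n. F xs ys - F xs (permute_list (\<pi> xs) ys))) \<in> R"
    by (intro exchangeable_add_sum[OF exch \<open>g \<in> R\<close> finite_samples])
  also have "(\<lambda>ys. g ys + (\<Sum>xs\<in>samples n. F xs ys - F xs (permute_list (\<pi> xs) ys))) = f"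
  proof
    fix ys :: "'x list"
    have permuted: "F xs (permute_list (\<pi> xs) ys) = (if rep xs = ys then h xs else 0)"
      if "xs \<in> samples n" for xs
    proof (cases "length ys = n")
      case True
      have "length (rep xs) = n"
        using that mset_eq_length[OF mset_rep[of xs]] by (simp add: samples_def)
      then have "permute_list (\<pi> xs) ys = xs \<longleftrightarrow> ys = rep xs"
        using \<pi>[of xs] that True permute_list_eq_iff[of "\<pi> xs" n ys "rep xs"]
        by (simp add: samples_def)
      then show ?thesis by (auto simp: F_def)
    next
      case False
      then have "length (permute_list (\<pi> xs) ys) \<noteq> length xs"
        using that by (simp add: samples_def)
      then have "permute_list (\<pi> xs) ys \<noteq> xs" by metis
      then show ?thesis
        using that False mset_eq_length[OF mset_rep[of xs]] by (auto simp: F_def samples_def)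
    qed
    \<comment> \<open>At a representative this is the sum of \<open>h\<close> over its class;
      elsewhere no term contributes.\<close>
    have "(\<Sum>xs\<in>samples n. if rep xs = ys then h xs else 0) = 0"
    proof (cases "\<exists>xs\<in>samples n. rep xs = ys")
      case True
      then obtain xs where xs: "length xs = n" "rep xs = ys" by (auto simp: samples_def)
      have "rep zs = ys \<longleftrightarrow> mset zs = mset xs" for zs
        using xs rep_eq mset_rep by metis
      then have "{zs \<in> samples n. rep zs = ys} = {zs. mset zs = mset xs}"
        using xs by (auto simp: samples_def dest: mset_eq_length)
      then show ?thesis
        using sum0[OF xs(1)] by (simp add: finite_samples flip: sum.inter_filter)
    qed (auto intro: sum.neutral)
    moreover have "(\<Sum>xs\<in>samples n. F xs ys) = h ys"
      using h0[of ys] by (simp add: F_def finite_samples) (simp add: samples_def)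
    ultimately show "g ys + (\<Sum>xs\<in>samples n. F xs ys - F xs (permute_list (\<pi> xs) ys)) = f ys"
      using permuted by (simp add: sum_subtractf h_def)
  qed
  finally show ?thesis .
qed

section \<open>Updating\<close>

text \<open>Padding a sample of size \<open>a\<close> with an arbitrary category recovers a gamble
  from its extension.\<close>

lemma ext_eq_imp_eq:
  fixes f g :: "'x::finite list \<Rightarrow> real"
  assumes "a \<le> b" "f \<in> gambles (samples a)" "g \<in> gambles (samples a)" "ext a b f = ext a b g"
  shows "f = g"
proof
  fix xs :: "'x list"
  show "f xs = g xs"
  proof (cases "length xs = a")
    case True
    then show ?thesis
      using fun_cong[OF assms(4), of "xs @ replicate (b - a) undefined"] assms(1)
      by (simp add: ext_def samples_def)
  qed (use assms in \<open>simp add: mem_gambles_samples_iff\<close>)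
qed

text \<open>Injectivity of \<open>ext a b\<close> on gambles turns the equality of sets into an
  equivalence for each gamble, the form in which time consistency is used and proved below.\<close>

lemma time_consistent_iff:
  fixes R :: "nat \<Rightarrow> ('x::finite list \<Rightarrow> real) set"
  assumes "\<And>n. 1 \<le> n \<Longrightarrow> R n \<subseteq> gambles (samples n)"
  shows "time_consistent R \<longleftrightarrow> (\<forall>a b. 1 \<le> a \<longrightarrow> a \<le> b \<longrightarrow>
    (\<forall>f\<in>gambles (samples a). ext a b f \<in> R b \<longleftrightarrow> f \<in> R a))"
proof -
  have "ext a b ` R a = R b \<inter> ext a b ` gambles (samples a) \<longleftrightarrow>
      (\<forall>f\<in>gambles (samples a). ext a b f \<in> R b \<longleftrightarrow> f \<in> R a)" if "1 \<le> a" "a \<le> b" for a b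
    using assms[OF that(1)] ext_eq_imp_eq[OF that(2)] by blast
  then show ?thesis by (auto simp: time_consistent_def)
qed

text \<open>Conditioning reads the first \<open>k\<close> observations and extension ignores the
  last \<open>b - a\<close>, so the two commute.\<close>

lemma conditioned_ext:
  fixes m :: "'x::finite \<Rightarrow> nat"
  assumes "m \<in> count_vectors k" "a \<le> b"
  shows "conditioned k m b (ext a b f) = ext (k + a) (k + b) (conditioned k m a f)"
  using assms by (auto simp: conditioned_eq_tensor tensor_def ext_def samples_def min_def
      drop_take fun_eq_iff)

text \<open>The permutation \<sigma> fixes the first \<open>k\<close> positions, which carry the
  observed counts, and lets \<pi> act on the others.\<close>

lemma conditioned_permute_list:
  fixes m :: "'x::finite \<Rightarrow> nat"
  assumes m: "m \<in> count_vectors k" and \<pi>: "\<pi> permutes {..<n}"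
  obtains \<sigma> where "\<sigma> permutes {..<k + n}"
    "\<And>f. conditioned k m n (\<lambda>xs. f (permute_list \<pi> xs)) =
      (\<lambda>xs. conditioned k m n f (permute_list \<sigma> xs))"
proof -
  define \<sigma> where "\<sigma> i = (if i < k then i else k + \<pi> (i - k))" for i
  define \<tau> where "\<tau> i = (if i < k then i else k + inv \<pi> (i - k))" for i
  have "\<sigma> permutes {..<k + n}"
    unfolding permutes_def bij_iff[symmetric]
  proof (intro conjI allI impI)
    show "bij \<sigma>"
      by (rule o_bij[of \<tau>]) (auto simp: \<sigma>_def \<tau>_def fun_eq_iff permutes_inverses[OF \<pi>])
    fix i assume "i \<notin> {..<k + n}"
    then show "\<sigma> i = i" using permutes_not_in[OF \<pi>, of "i - k"] by (auto simp: \<sigma>_def)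
  qed
  moreover have "conditioned k m n (\<lambda>xs. f (permute_list \<pi> xs)) xs =
      conditioned k m n f (permute_list \<sigma> xs)" for f xs
  proof (cases "length xs = k + n")
    case True
    have "take k (permute_list \<sigma> xs) = take k xs"
      using True by (intro nth_equalityI) (auto simp: permute_list_def \<sigma>_def)
    moreover have "drop k (permute_list \<sigma> xs) = permute_list \<pi> (drop k xs)"
      using True permutes_in_image[OF \<pi>]
      by (intro nth_equalityI) (auto simp: permute_list_def \<sigma>_def)
    ultimately show ?thesis by (simp add: conditioned_eq_tensor[OF m] tensor_def True)
  qed (simp add: conditioned_eq_tensor[OF m] tensor_def)
  ultimately show thesis by (intro that[of \<sigma>]) auto
qed

section \<open>The axioms for the updated family\<close>

text \<open>Conditioning is linear and sends positive gambles to positive gambles, so each axiom is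
  pulled back from \<open>R (k + n)\<close>.\<close>

lemma coherent_update_family:
  fixes m :: "'x::finite \<Rightarrow> nat"
  assumes m: "m \<in> count_vectors k" and coh: "coherent (samples (k + n)) (R (k + n))"
  shows "coherent (samples n) (update_family k m R n)"
proof -
  let ?C = "conditioned k m n"
  have "f \<in> update_family k m R n" if f: "f \<in> gambles (samples n)" "(\<lambda>_. 0) < f" for f
  proof -
    have nonneg: "0 \<le> f xs" for xs using f(2) by (auto simp: less_fun_def le_fun_def)
    have "f \<noteq> (\<lambda>_. 0)" using f(2) by auto
    then obtain xs where xs: "f xs \<noteq> 0" by auto
    then have "length xs = n" using f(1) by (auto simp: mem_gambles_samples_iff)
    \<comment> \<open>A sample with count vector \<open>m\<close> followed by \<open>xs\<close> is a
      point where the conditioned gamble does not vanish.\<close>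
    obtain ys where ys: "ys \<in> count_atom m" using count_atom_nonempty by blast
    have "?C f (ys @ xs) \<noteq> 0"
      using xs ys length_count_atom[OF m ys] \<open>length xs = n\<close>
      by (simp add: conditioned_eq_tensor[OF m] tensor_def)
    moreover have "0 \<le> ?C f zs" for zs using nonneg by (simp add: conditioned_def)
    ultimately have "(\<lambda>_. 0) < ?C f"
      by (auto simp: less_fun_def le_fun_def not_le intro!: exI[of _ "ys @ xs"] order.not_eq_order_implies_strict)
    moreover have "?C f \<in> gambles (samples (k + n))"
      by (simp add: conditioned_eq_tensor[OF m] tensor_in_gambles)
    ultimately show ?thesis using coh f(1) by (auto simp: coherent_def update_family_def)
  qed
  moreover have "(\<lambda>_. 0) \<notin> update_family k m R n"
    using coh by (simp add: coherent_def update_family_def conditioned_def)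
  moreover have "(\<lambda>x. c * f x) \<in> update_family k m R n" if "f \<in> update_family k m R n" "0 < c" for f c
  proof -
    have "?C (\<lambda>x. c * f x) = (\<lambda>x. c * ?C f x)" by (simp add: conditioned_def mult.assoc)
    then show ?thesis
      using that coh by (auto simp: coherent_def update_family_def mem_gambles_samples_iff)
  qed
  moreover have "(\<lambda>x. f x + g x) \<in> update_family k m R n"
    if "f \<in> update_family k m R n" "g \<in> update_family k m R n" for f g
  proof -
    have "?C (\<lambda>x. f x + g x) = (\<lambda>x. ?C f x + ?C g x)" by (simp add: conditioned_def algebra_simps)
    then show ?thesis
      using that coh by (auto simp: coherent_def update_family_def mem_gambles_samples_iff)
  qed
  ultimately show ?thesis by (auto simp: coherent_def update_family_def)
qed

text \<open>Conditioning turns an exchangeable difference for \<pi> into one for the shifted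
  permutation \<sigma> at sample size \<open>k + n\<close>.\<close>

lemma exchangeable_update_family:
  fixes m :: "'x::finite \<Rightarrow> nat"
  assumes m: "m \<in> count_vectors k" and exch: "exchangeable (k + n) (R (k + n))"
  shows "exchangeable n (update_family k m R n)"
  unfolding exchangeable_def
proof (intro ballI allI impI)
  let ?C = "conditioned k m n"
  fix h f :: "'x list \<Rightarrow> real" and \<pi>
  assume h: "h \<in> update_family k m R n" and f: "f \<in> gambles (samples n)"
    and \<pi>: "\<pi> permutes {..<n}"
  obtain \<sigma> where \<sigma>: "\<sigma> permutes {..<k + n}"
    "\<And>f. ?C (\<lambda>xs. f (permute_list \<pi> xs)) = (\<lambda>xs. ?C f (permute_list \<sigma> xs))"
    using conditioned_permute_list[OF m \<pi>] by blast
  have "?C (\<lambda>xs. h xs + (f xs - f (permute_list \<pi> xs))) =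
      (\<lambda>xs. ?C h xs + (?C f xs - ?C (\<lambda>xs. f (permute_list \<pi> xs)) xs))"
    by (simp add: conditioned_def algebra_simps)
  also have "\<dots> = (\<lambda>xs. ?C h xs + (?C f xs - ?C f (permute_list \<sigma> xs)))"
    by (simp only: \<sigma>(2))
  also have "\<dots> \<in> R (k + n)"
  proof -
    have "?C f \<in> gambles (samples (k + n))"
      by (simp add: conditioned_eq_tensor[OF m] tensor_in_gambles)
    then show ?thesis using exch h \<sigma>(1) by (auto simp: exchangeable_def update_family_def)
  qed
  finally show "(\<lambda>xs. h xs + (f xs - f (permute_list \<pi> xs))) \<in> update_family k m R n"
    using h f by (auto simp: update_family_def mem_gambles_samples_iff)
qed

text \<open>Conditioning commutes with extension, so the claim for \<open>a\<close> and
  \<open>b\<close> is time consistency of \<open>R\<close> between \<open>k + a\<close> and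
  \<open>k + b\<close>.\<close>

lemma time_consistent_update_family:
  fixes R :: "nat \<Rightarrow> ('x::finite list \<Rightarrow> real) set"
  assumes m: "m \<in> count_vectors k" and R: "\<And>n. 1 \<le> n \<Longrightarrow> R n \<subseteq> gambles (samples n)"
    and tc: "time_consistent R"
  shows "time_consistent (update_family k m R)"
proof (subst time_consistent_iff)
  show "update_family k m R n \<subseteq> gambles (samples n)" for n by (auto simp: update_family_def)
  show "\<forall>a b. 1 \<le> a \<longrightarrow> a \<le> b \<longrightarrow> (\<forall>f\<in>gambles (samples a).
      ext a b f \<in> update_family k m R b \<longleftrightarrow> f \<in> update_family k m R a)"
  proof (intro allI impI ballI)
    fix a b :: nat and f :: "'x list \<Rightarrow> real"
    assume ab: "1 \<le> a" "a \<le> b" and f: "f \<in> gambles (samples a)"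
    have "conditioned k m a f \<in> gambles (samples (k + a))"
      by (simp add: conditioned_eq_tensor[OF m] tensor_in_gambles)
    then have "ext (k + a) (k + b) (conditioned k m a f) \<in> R (k + b) \<longleftrightarrow> conditioned k m a f \<in> R (k + a)"
      using iffD1[OF time_consistent_iff[OF R] tc, rule_format, of "k + a" "k + b"] ab by simp
    then show "ext a b f \<in> update_family k m R b \<longleftrightarrow> f \<in> update_family k m R a"
      using f by (simp add: update_family_def ext_in_gambles conditioned_ext[OF m ab(2)])
  qed
qed

theorem theorem23:
  fixes R :: "nat \<Rightarrow> ('x::finite list \<Rightarrow> real) set"
    and H :: "(real ^ 'x \<Rightarrow> real) set"
    and k :: nat
    and m :: "'x \<Rightarrow> nat"
  assumes "coherent_exchangeable_time_consistent R"
    and "H = frequency_representation R"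
    and "1 \<le> k"
    and "m \<in> count_vectors k"
  shows "coherent_exchangeable_time_consistent (update_family k m R)
    \<and> frequency_representation (update_family k m R) = update_representation m H"
proof (intro conjI set_eqI iffI)
  note m = assms(4)
  have coh: "coherent (samples n) (R n)" and exch: "exchangeable n (R n)" if "1 \<le> n" for n
    using assms(1) that by (auto simp: coherent_exchangeable_time_consistent_def)
  have R: "R n \<subseteq> gambles (samples n)" if "1 \<le> n" for n
    using coh[OF that] by (simp add: coherent_def)
  have tc: "time_consistent R"
    using assms(1) by (simp add: coherent_exchangeable_time_consistent_def)
  show "coherent_exchangeable_time_consistent (update_family k m R)"
    unfolding coherent_exchangeable_time_consistent_def
    using coherent_update_family[OF m] exchangeable_update_family[OF m]
      time_consistent_update_family[OF m R tc] coh exch by auto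
  fix p
  {
    assume "p \<in> frequency_representation (update_family k m R)"
    then obtain n f where n: "1 \<le> n" and f: "f \<in> update_family k m R n" and p: "p = Mn n f"
      by (auto simp: frequency_representation_def)
    have "Mn (k + n) (conditioned k m n f) \<in> H"
      using f n by (auto simp: assms(2) frequency_representation_def update_family_def)
    then show "p \<in> update_representation m H"
      by (simp add: update_representation_def p Mn_in_simplex_polynomials Mn_conditioned[OF m])
  next
    assume "p \<in> update_representation m H"
    then have "p \<in> simplex_polynomials" and "(\<lambda>\<theta>. bernstein m \<theta> * p \<theta>) \<in> H"
      by (auto simp: update_representation_def)
    then obtain n f N g where n: "1 \<le> n" "p = Mn n f"
      and N: "1 \<le> N" "g \<in> R N" "(\<lambda>\<theta>. bernstein m \<theta> * p \<theta>) = Mn N g"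
      by (auto simp: assms(2) frequency_representation_def elim!: simplex_polynomial_eq_Mn)
    \<comment> \<open>Large enough to extend \<open>f\<close> to \<open>M\<close> observations and
      \<open>g\<close> to \<open>k + M\<close>, so that the conditioned \<open>f\<close> and
      \<open>g\<close> can be compared at one sample size.\<close>
    define M where "M = max n N"
    have M: "1 \<le> M" "n \<le> M" "N \<le> k + M" using n(1) by (auto simp: M_def)
    have p: "p = Mn M (ext n M f)" by (simp add: n(2) Mn_ext[OF M(2)])
    have "ext N (k + M) g \<in> R (k + M)"
      using iffD1[OF time_consistent_iff[OF R] tc, rule_format, of N "k + M" g] N(1,2) M(3) R[OF N(1)]
      by (simp add: subsetD)
    \<comment> \<open>Both sides are the product of \<open>bernstein m\<close> and
      \<open>p\<close>.\<close>
    moreover have "Mn (k + M) (conditioned k m M (ext n M f)) = Mn (k + M) (ext N (k + M) g)"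
      using N(3) p by (simp add: Mn_conditioned[OF m] Mn_ext[OF M(3)])
    moreover have "conditioned k m M (ext n M f) \<in> gambles (samples (k + M))"
      by (simp add: conditioned_eq_tensor[OF m] tensor_in_gambles)
    \<comment> \<open>The extension of \<open>g\<close> is desirable by time consistency, and
      exchangeability passes this on to any gamble with the same polynomial.\<close>
    ultimately have "conditioned k m M (ext n M f) \<in> R (k + M)"
      using exchangeable_mem_if_Mn_eq[OF exch[of "k + M"]] R[of "k + M"] M(1) by simp
    then have "ext n M f \<in> update_family k m R M"
      by (simp add: update_family_def ext_in_gambles)
    then show "p \<in> frequency_representation (update_family k m R)"
      using M(1) p by (auto simp: frequency_representation_def)
  }
qed

end
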